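(* Suppose that $\varphi$ is an analytic self-map of the unit disk $D$, $u\in H(D)$, $0<p<\infty$, and that $\phi$ is normal on $[0,1)$. Then the weighted composition operator $uC_\varphi : H(p,p,\phi)\to\mathcal{B}_0$ is bounded if and only if $uC_\varphi : H(p,p,\phi)\to\mathcal{B}$ is bounded, $u\in\mathcal{B}_0$ and $$\lim_{|z|\to1}(1-|z|^2)|u(z)\varphi'(z)|=0.$$
   Context: $D$ is the open unit disk in $\mathbb{C}$ and $H(D)$ is the class of all analytic functions on $D$. An analytic self-map of $D$ is an analytic function $\varphi:D\to D$. For $u\in H(D)$, the weighted composition operator is $uC_\varphi f=u\cdot(f\circ\varphi)$, $f\in H(D)$. A positive continuous function $\phi$ on $[0,1)$ is called normal if there exist $s,t$ with $0<s<t$ such that $\frac{\phi(r)}{(1-r)^s}\downarrow 0$ and $\frac{\phi(r)}{(1-r)^t}\uparrow\infty$ as $r\to1^-$. For $0<p<\infty$ and normal $\phi$, $H(p,p,\phi)$ is the space of all $f\in H(D)$ such that $\|f\|_{H(p,p,\phi)}=\left(\int_0^1 M_p^p(f,r)\frac{\phi^p(r)}{1-r}\,r\,dr\right)^{1/p}<\infty$, where $M_p(f,r)=\left(\frac1{2\pi}\int_0^{2\pi}|f(re^{i\theta})|^p\,d\theta\right)^{1/p}$, $0\le r<1$ (a norm for $p\ge1$, a quasinorm for $0<p<1$). The Bloch space $\mathcal{B}$ is the space of $f\in H(D)$ with $B(f)=\sup_{z\in D}(1-|z|^2)|f'(z)|<\infty$, normed by $\|f\|_{\mathcal{B}}=|f(0)|+B(f)$.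 The little Bloch space $\mathcal{B}_0$ is the subspace of those $f\in\mathcal{B}$ with $(1-|z|^2)|f'(z)|\to0$ as $|z|\to1$, with the norm of $\mathcal{B}$. A linear operator is bounded if it maps the first space into the second and the image of every bounded set is bounded. *)

theory Defs
  imports "HOL-Complex_Analysis.Complex_Analysis"
begin

text \<open>
  Functions on the open unit disk \<open>D\<close> are rendered as total functions on the complex numbers;
  every notion below depends only on their values in \<open>D\<close>.
\<close>

abbreviation unit_disk :: "complex set" where
  "unit_disk \<equiv> ball 0 1"

definition analytic_self_map :: "(complex \<Rightarrow> complex) \<Rightarrow> bool" where
  "analytic_self_map \<psi> \<longleftrightarrow> \<psi> holomorphic_on unit_disk \<and> \<psi> ` unit_disk \<subseteq> unit_disk"

definition weighted_comp ::
    "(complex \<Rightarrow> complex) \<Rightarrow> (complex \<Rightarrow> complex) \<Rightarrow> (complex \<Rightarrow> complex) \<Rightarrow> complex \<Rightarrow> complex" where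
  "weighted_comp u \<psi> f = (\<lambda>z. u z * f (\<psi> z))"

text \<open>
  The arrows in \<open>\<phi>(r)/(1-r)^s \<down> 0\<close> and \<open>\<phi>(r)/(1-r)^t \<up> \<infinity>\<close> as \<open>r \<rightarrow> 1-\<close> are read as (weak)
  monotonicity on some interval \<open>[\<delta>, 1)\<close> together with the limit; monotonicity on all of
  \<open>[0, 1)\<close> is the special case \<open>\<delta> = 0\<close>.
\<close>

definition normal_weight :: "(real \<Rightarrow> real) \<Rightarrow> bool" where
  "normal_weight \<phi> \<longleftrightarrow>
     continuous_on {0..<1} \<phi> \<and> (\<forall>r\<in>{0..<1}. 0 < \<phi> r) \<and>
     (\<exists>s t \<delta>. 0 < s \<and> s < t \<and> 0 \<le> \<delta> \<and> \<delta> < 1 \<and>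
        antimono_on {\<delta>..<1} (\<lambda>r. \<phi> r / (1 - r) powr s) \<and>
        ((\<lambda>r. \<phi> r / (1 - r) powr s) \<longlongrightarrow> 0) (at_left 1) \<and>
        mono_on {\<delta>..<1} (\<lambda>r. \<phi> r / (1 - r) powr t) \<and>
        filterlim (\<lambda>r. \<phi> r / (1 - r) powr t) at_top (at_left 1))"

definition integral_mean :: "real \<Rightarrow> (complex \<Rightarrow> complex) \<Rightarrow> real \<Rightarrow> real" where
  "integral_mean p f r =
     (1 / (2 * pi) * (LBINT \<theta>:{0..2*pi}. norm (f (of_real r * cis \<theta>)) powr p)) powr (1 / p)"

definition mixed_integrand ::
    "real \<Rightarrow> (real \<Rightarrow> real) \<Rightarrow> (complex \<Rightarrow> complex) \<Rightarrow> real \<Rightarrow> real" where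
  "mixed_integrand p \<phi> f r = integral_mean p f r powr p * (\<phi> r powr p / (1 - r)) * r"

text \<open>
  The integrand is nonnegative and, for holomorphic \<open>f\<close> and continuous positive \<open>\<phi>\<close>, continuous
  on \<open>[0, 1)\<close>, so integrability says exactly that the integral is finite.
\<close>

definition mixed_norm_space :: "real \<Rightarrow> (real \<Rightarrow> real) \<Rightarrow> (complex \<Rightarrow> complex) set" where
  "mixed_norm_space p \<phi> =
     {f. f holomorphic_on unit_disk \<and> set_integrable lborel {0..<1} (mixed_integrand p \<phi> f)}"

definition mixed_norm :: "real \<Rightarrow> (real \<Rightarrow> real) \<Rightarrow> (complex \<Rightarrow> complex) \<Rightarrow> real" where
  "mixed_norm p \<phi> f = (LBINT r:{0..<1}. mixed_integrand p \<phi> f r) powr (1 / p)"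

definition bloch_space :: "(complex \<Rightarrow> complex) set" where
  "bloch_space =
     {f. f holomorphic_on unit_disk \<and>
         bdd_above ((\<lambda>z. (1 - (norm z)\<^sup>2) * norm (deriv f z)) ` unit_disk)}"

definition bloch_norm :: "(complex \<Rightarrow> complex) \<Rightarrow> real" where
  "bloch_norm f = norm (f 0) + (SUP z\<in>unit_disk. (1 - (norm z)\<^sup>2) * norm (deriv f z))"

text \<open>The filter for \<open>|z| \<rightarrow> 1\<close> with \<open>z\<close> in the disk.\<close>

definition to_unit_circle :: "complex filter" where
  "to_unit_circle = filtercomap norm (at_left 1)"

definition little_bloch_space :: "(complex \<Rightarrow> complex) set" where
  "little_bloch_space =
     {f \<in> bloch_space.
        ((\<lambda>z. (1 - (norm z)\<^sup>2) * norm (deriv f z)) \<longlongrightarrow> 0) to_unit_circle}"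

text \<open>
  Boundedness of an operator between function spaces given by carriers \<open>X\<close>, \<open>Y\<close> and
  (quasi)norms \<open>NX\<close>, \<open>NY\<close>.
\<close>

definition bounded_operator ::
    "'a set \<Rightarrow> ('a \<Rightarrow> real) \<Rightarrow> 'b set \<Rightarrow> ('b \<Rightarrow> real) \<Rightarrow> ('a \<Rightarrow> 'b) \<Rightarrow> bool" where
  "bounded_operator X NX Y NY T \<longleftrightarrow>
     T ` X \<subseteq> Y \<and>
     (\<forall>S\<subseteq>X. (\<exists>C. \<forall>f\<in>S. NX f \<le> C) \<longrightarrow> (\<exists>C. \<forall>g\<in>T ` S. NY g \<le> C))"

end

theory Submission
  imports Defs
begin

text \<open>
  Write \<open>T f = u * (f \<circ> \<psi>)\<close>. If \<open>T\<close> maps boundedly into the little Bloch space, then the images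
  \<open>T 1 = u\<close> and \<open>T z = u * \<psi>\<close> lie there, because normality of the weight makes every bounded holomorphic
  function an element of the mixed norm space (\<open>bounded_holomorphic_in_mixed_norm_space\<close>). Since
  \<open>u * \<psi>' = (u * \<psi>)' - u' * \<psi>\<close> and \<open>\<bar>\<psi>\<bar> < 1\<close>, the limit condition follows.

  For the converse, the two little-o conditions show at once that \<open>(1 - \<bar>z\<bar>\<^sup>2) * \<bar>(T g)' z\<bar> \<rightarrow> 0\<close> whenever
  \<open>g\<close> and \<open>g'\<close> are bounded on the disk (\<open>weighted_comp_deriv_tendsto_0\<close>). Dilations \<open>f(\<rho> z)\<close> with
  \<open>\<rho> < 1\<close> are of this kind. They converge to \<open>f\<close> in the mixed norm as \<open>\<rho> \<rightarrow> 1\<close>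
  (\<open>mixed_norm_diff_dilation\<close>), so boundedness of \<open>T\<close> into the Bloch space makes the images converge
  in the Bloch seminorm, and the little-o condition passes to the limit.

  The analytic core is the convergence of dilations for arbitrary \<open>p > 0\<close>. It is an application of
  dominated convergence once \<open>M\<^sub>p(f, \<rho> r) \<le> M\<^sub>p(f, r)\<close> is known (\<open>circle_integral_mono\<close>). This
  monotonicity is obtained from a maximum principle for finite sums \<open>\<Sum>i. \<bar>F i\<bar>\<^sup>p\<close> of powers of moduli
  of holomorphic functions (\<open>sum_norm_powr_maximum_principle\<close>), applied to the rotations of \<open>f\<close> by
  equally spaced angles; the corresponding sums are Riemann sums of the integral means.
\<close>

section \<open>A maximum principle for sums of powers of moduli\<close>

lemma nonvanishing_imp_norm_powr_eq_norm_holomorphic: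
  fixes f :: "complex \<Rightarrow> complex" and p :: real
  assumes "f holomorphic_on S" "contractible S" "\<And>z. z \<in> S \<Longrightarrow> f z \<noteq> 0"
  obtains h where "h holomorphic_on S" "\<And>z. z \<in> S \<Longrightarrow> norm (h z) = norm (f z) powr p"
proof -
  obtain L where L: "L holomorphic_on S" "\<And>z. z \<in> S \<Longrightarrow> f z = exp (L z)"
    using contractible_imp_holomorphic_log[OF assms] by blast
  show thesis
  proof
    show "(\<lambda>z. exp (of_real p * L z)) holomorphic_on S"
      by (intro holomorphic_intros L)
    show "norm (exp (of_real p * L z)) = norm (f z) powr p" if "z \<in> S" for z
      using L(2)[OF that] by (simp add: powr_def)
  qed
qed

text \<open>
  At a local maximum \<open>a\<close>, the terms with \<open>F i a = 0\<close> can be dropped without changing the value at \<open>a\<close>.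
  Near \<open>a\<close> each remaining term is \<open>\<bar>h i\<bar>\<close> for a holomorphic \<open>h i\<close>, a branch of \<open>(F i)\<^sup>p\<close>. Multiplying
  \<open>h i\<close> by the unimodular constant that makes its value at \<open>a\<close> positive and adding up gives one
  holomorphic function \<open>H\<close> with \<open>\<bar>H\<bar> \<le> \<Sum>i. \<bar>F i\<bar>\<^sup>p\<close> near \<open>a\<close> and equality at \<open>a\<close>, so that the maximum
  modulus principle for \<open>H\<close> applies. This is the subharmonicity of \<open>\<bar>F\<bar>\<^sup>p\<close> in the only form used
  here; it involves no integrals.
\<close>

lemma sum_norm_powr_local_max_imp_locally_constant:
  fixes F :: "'i \<Rightarrow> complex \<Rightarrow> complex" and p :: real
  assumes "finite I" "0 < e" and hol: "\<And>i. i \<in> I \<Longrightarrow> F i holomorphic_on ball a e"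
    and max: "\<And>w. w \<in> ball a e \<Longrightarrow>
      (\<Sum>i\<in>I. norm (F i w) powr p) \<le> (\<Sum>i\<in>I. norm (F i a) powr p)"
  obtains d where "0 < d" "d \<le> e"
    "\<And>w. w \<in> ball a d \<Longrightarrow>
      (\<Sum>i\<in>I. norm (F i w) powr p) = (\<Sum>i\<in>I. norm (F i a) powr p)"
proof -
  define g where "g w = (\<Sum>i\<in>I. norm (F i w) powr p)" for w
  define J where "J = {i \<in> I. F i a \<noteq> 0}"
  have J: "finite J" "J \<subseteq> I"
    using \<open>finite I\<close> by (auto simp: J_def)
  have "\<forall>\<^sub>F w in nhds a. F i w \<noteq> 0" if "i \<in> J" for i
  proof -
    have "isCont (F i) a"
      using hol[of i] that J \<open>0 < e\<close>
      by (intro continuous_on_interior[of "ball a e"] holomorphic_on_imp_continuous_on) auto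
    then have "(F i \<longlongrightarrow> F i a) (nhds a)"
      by (simp add: isCont_def tendsto_at_iff_tendsto_nhds)
    then show ?thesis
      using that by (auto simp: J_def intro!: tendsto_imp_eventually_ne)
  qed
  then have "\<forall>\<^sub>F w in nhds a. \<forall>i\<in>J. F i w \<noteq> 0"
    using J by (simp add: eventually_ball_finite)
  then obtain d0 where d0: "0 < d0" "\<And>w i. dist w a < d0 \<Longrightarrow> i \<in> J \<Longrightarrow> F i w \<noteq> 0"
    unfolding eventually_nhds_metric by blast
  define d where "d = min d0 e"
  have d: "0 < d" "d \<le> e" "ball a d \<subseteq> ball a e"
    using d0 \<open>0 < e\<close> by (auto simp: d_def)
  have "\<exists>h. h holomorphic_on ball a d \<and> (\<forall>z\<in>ball a d. norm (h z) = norm (F i z) powr p)"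
    if "i \<in> J" for i
  proof -
    have "F i holomorphic_on ball a d"
      using hol that J d by (blast intro: holomorphic_on_subset)
    moreover have "F i z \<noteq> 0" if "z \<in> ball a d" for z
      using d0(2)[of z i] that \<open>i \<in> J\<close> by (auto simp: d_def dist_commute)
    ultimately show ?thesis
      using nonvanishing_imp_norm_powr_eq_norm_holomorphic[of "F i" "ball a d" p]
      by (metis convex_ball convex_imp_contractible)
  qed
  then obtain h where h: "\<And>i. i \<in> J \<Longrightarrow> h i holomorphic_on ball a d"
      "\<And>i z. i \<in> J \<Longrightarrow> z \<in> ball a d \<Longrightarrow> norm (h i z) = norm (F i z) powr p"
    by metis
  \<comment> \<open>\<open>cnj (sgn v) * v\<close> is \<open>\<bar>v\<bar>\<close>, so that all summands of \<open>H\<close> are nonnegative at \<open>a\<close>.\<close>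
  define H where "H z = (\<Sum>i\<in>J. cnj (sgn (h i a)) * h i z)" for z
  have norm_cs: "norm (cnj (sgn w) * v) \<le> norm v" for w v :: complex
    by (simp add: norm_mult norm_sgn)
  have H_le: "norm (H z) \<le> g z" if "z \<in> ball a d" for z
  proof -
    have "norm (H z) \<le> (\<Sum>i\<in>J. norm (h i z))"
      unfolding H_def by (intro sum_norm_le norm_cs)
    also have "\<dots> = (\<Sum>i\<in>J. norm (F i z) powr p)"
      using h that by (intro sum.cong) auto
    also have "\<dots> \<le> g z"
      unfolding g_def using J \<open>finite I\<close> by (intro sum_mono2) auto
    finally show ?thesis .
  qed
  have cs: "cnj (sgn w) * w = of_real (norm w)" for w :: complex
    by (cases "w = 0")
      (auto simp: sgn_div_norm scaleR_conv_of_real field_simps complex_norm_square[symmetric]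
        power2_eq_square)
  have "H a = of_real (\<Sum>i\<in>J. norm (h i a))"
    by (simp add: H_def cs)
  also have "(\<Sum>i\<in>J. norm (h i a)) = (\<Sum>i\<in>J. norm (F i a) powr p)"
    using h d by (intro sum.cong) auto
  also have "\<dots> = g a"
    unfolding g_def using \<open>finite I\<close> by (intro sum.mono_neutral_left) (auto simp: J_def)
  finally have Ha: "H a = of_real (g a)" .
  have g_ge: "0 \<le> g w" for w
    by (simp add: g_def sum_nonneg)
  have gmax: "g w \<le> g a" if "w \<in> ball a d" for w
    using max[of w] that d by (auto simp: g_def)
  have "H constant_on ball a d"
  proof (rule maximum_modulus_principle[where U = "ball a d" and \<xi> = a])
    show "H holomorphic_on ball a d"
      unfolding H_def by (intro holomorphic_intros h)
    show "norm (H z) \<le> norm (H a)" if "z \<in> ball a d" for z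
      using H_le[OF that] gmax[OF that] g_ge[of a] by (simp add: Ha)
  qed (use d in auto)
  then have "H w = H a" if "w \<in> ball a d" for w
    using that d by (auto simp: constant_on_def)
  then have "g a \<le> g w" if "w \<in> ball a d" for w
    using H_le[OF that] that g_ge[of a] by (simp add: Ha)
  with gmax d show thesis
    unfolding g_def by (intro that[of d]) (auto intro: antisym)
qed

lemma continuous_on_norm_powr:
  fixes f :: "'a::topological_space \<Rightarrow> 'b::real_normed_vector" and p :: real
  assumes "continuous_on S f" "0 < p"
  shows "continuous_on S (\<lambda>z. norm (f z) powr p)"
  using assms by (intro continuous_on_powr' continuous_intros) auto

text \<open>
  Among the maximum points in \<open>K\<close>, one that is farthest from the origin cannot be interior: the sum
  would be constant on a disk around it, and this disk contains points farther out.
\<close>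

lemma sum_norm_powr_maximum_principle:
  fixes F :: "'i \<Rightarrow> complex \<Rightarrow> complex" and p :: real
  assumes "finite I" "0 < p" and K: "compact K" "z \<in> K"
    and S: "open S" "K \<subseteq> S" and hol: "\<And>i. i \<in> I \<Longrightarrow> F i holomorphic_on S"
  obtains w where "w \<in> frontier K"
    "(\<Sum>i\<in>I. norm (F i z) powr p) \<le> (\<Sum>i\<in>I. norm (F i w) powr p)"
proof -
  define g where "g w = (\<Sum>i\<in>I. norm (F i w) powr p)" for w
  have contg: "continuous_on K g"
    unfolding g_def using hol S \<open>0 < p\<close>
    by (intro continuous_on_sum continuous_on_norm_powr)
       (meson continuous_on_subset holomorphic_on_imp_continuous_on)+
  obtain m where m: "m \<in> K" "\<And>w. w \<in> K \<Longrightarrow> g w \<le> g m"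
    using continuous_attains_sup[OF K(1) _ contg] K(2) by auto
  define M where "M = {w \<in> K. g w = g m}"
  have "compact M"
    unfolding M_def using K(1) contg
    by (auto simp: compact_eq_bounded_closed intro: bounded_subset
        continuous_closed_preimage_constant)
  moreover have "M \<noteq> {}"
    using m by (auto simp: M_def)
  ultimately obtain a where a: "a \<in> M" "\<And>w. w \<in> M \<Longrightarrow> norm w \<le> norm a"
    using continuous_attains_sup[of M norm] by (auto intro: continuous_on_norm_id)
  have "a \<notin> interior K"
  proof
    assume "a \<in> interior K"
    then obtain e where e: "0 < e" "ball a e \<subseteq> K"
      by (meson mem_interior)
    have "g w \<le> g a" if "w \<in> ball a e" for w
      using that e a m by (auto simp: M_def)
    moreover have "F i holomorphic_on ball a e" if "i \<in> I" for i
      using hol[OF that] e S by (auto intro: holomorphic_on_subset)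
    ultimately obtain d where d: "0 < d" "d \<le> e" "\<And>w. w \<in> ball a d \<Longrightarrow> g w = g a"
      using sum_norm_powr_local_max_imp_locally_constant[OF \<open>finite I\<close> \<open>0 < e\<close>, of F a p]
      unfolding g_def by blast
    \<comment> \<open>\<open>b\<close> lies in the disk of constancy on the ray from the origin through \<open>a\<close>, beyond \<open>a\<close>; any ray serves if \<open>a = 0\<close>.\<close>
    define b where "b = a + of_real (d / 2) * (if a = 0 then 1 else sgn a)"
    have "b \<in> ball a d"
      using d(1) by (cases "a = 0") (simp_all add: b_def dist_norm norm_mult norm_sgn)
    moreover have "ball a d \<subseteq> K"
      using d(2) e(2) by (meson subset_ball subset_trans)
    ultimately have "b \<in> M"
      using d(3)[of b] a(1) unfolding M_def by auto
    have "norm b = norm a + d / 2"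
    proof (cases "a = 0")
      case True
      then show ?thesis
        using d(1) by (simp add: b_def)
    next
      case False
      then have "b = of_real (norm a + d / 2) * sgn a"
        by (simp add: b_def sgn_div_norm scaleR_conv_of_real field_simps)
      then have "norm b = \<bar>norm a + d / 2\<bar>"
        using False by (simp only: norm_mult norm_of_real norm_sgn) simp
      then show ?thesis
        using d(1) by simp
    qed
    with a(2)[OF \<open>b \<in> M\<close>] d(1) show False by simp
  qed
  with a have "a \<in> frontier K"
    using closure_subset by (auto simp: frontier_def M_def)
  moreover have "g z \<le> g a"
    using a m K by (auto simp: M_def)
  ultimately show thesis
    using that unfolding g_def by blast
qed

section \<open>Integral means grow with the radius\<close>

lemma riemann_sum_error:
  fixes h :: "real \<Rightarrow> real"
  assumes "continuous_on {0..real N * c} h" "0 \<le> c"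
    and osc: "\<And>x y. x \<in> {0..real N * c} \<Longrightarrow> y \<in> {0..real N * c} \<Longrightarrow> \<bar>x - y\<bar> \<le> c \<Longrightarrow>
      \<bar>h x - h y\<bar> \<le> e"
  shows "\<bar>integral {0..real N * c} h - c * (\<Sum>k<N. h (real k * c))\<bar> \<le> real N * c * e"
  using assms
proof (induction N)
  case 0
  then show ?case by simp
next
  case (Suc N)
  have Nc: "0 \<le> real N * c" "real N * c \<le> real (Suc N) * c"
    using Suc.prems by (auto simp: algebra_simps)
  have sub: "{0..real N * c} \<subseteq> {0..real (Suc N) * c}"
    using Nc by auto
  have IH: "\<bar>integral {0..real N * c} h - c * (\<Sum>k<N. h (real k * c))\<bar> \<le> real N * c * e"
  proof (rule Suc.IH)
    show "continuous_on {0..real N * c} h"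
      using Suc.prems(1) sub by (rule continuous_on_subset)
    show "\<bar>h x - h y\<bar> \<le> e"
      if "x \<in> {0..real N * c}" "y \<in> {0..real N * c}" "\<bar>x - y\<bar> \<le> c" for x y
      using Suc.prems(3) that sub by blast
  qed (use Suc.prems in auto)
  let ?J = "{real N * c..real (Suc N) * c}"
  have subJ: "?J \<subseteq> {0..real (Suc N) * c}"
    using Nc by auto
  have int: "h integrable_on {0..real (Suc N) * c}" "h integrable_on ?J"
    using Suc.prems(1) Nc by (auto intro!: integrable_continuous_interval
        intro: continuous_on_subset)
  have "integral ?J h - c * h (real N * c) = integral ?J (\<lambda>x. h x - h (real N * c))"
    using int Nc by (subst integral_diff) (auto simp: algebra_simps)
  also have "\<bar>\<dots>\<bar> \<le> e * (real (Suc N) * c - real N * c)"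
    unfolding real_norm_def[symmetric]
  proof (rule integral_bound)
    show "continuous_on ?J (\<lambda>x. h x - h (real N * c))"
      using Suc.prems(1) Nc by (intro continuous_intros) (auto intro: continuous_on_subset)
    show "norm (h x - h (real N * c)) \<le> e" if "x \<in> ?J" for x
      unfolding real_norm_def
    proof (rule Suc.prems(3))
      show "x \<in> {0..real (Suc N) * c}" "real N * c \<in> {0..real (Suc N) * c}"
        using that subJ Nc by auto
      show "\<bar>x - real N * c\<bar> \<le> c"
        using that by (simp add: algebra_simps)
    qed
  qed (use Nc in auto)
  finally have step: "\<bar>integral ?J h - c * h (real N * c)\<bar> \<le> c * e"
    by (simp add: algebra_simps)
  have "integral {0..real (Suc N) * c} h = integral {0..real N * c} h + integral ?J h"
    using Henstock_Kurzweil_Integration.integral_combine[OF Nc int(1)] by simp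
  then have "integral {0..real (Suc N) * c} h - c * (\<Sum>k<Suc N. h (real k * c)) =
      (integral {0..real N * c} h - c * (\<Sum>k<N. h (real k * c))) +
      (integral ?J h - c * h (real N * c))"
    by (simp add: algebra_simps)
  with IH step show ?case
    by (simp add: algebra_simps abs_if split: if_splits)
qed

lemma integral_periodic_shift:
  fixes h :: "real \<Rightarrow> real"
  assumes cont: "continuous_on UNIV h" and per: "\<And>x. h (x + T) = h x" and s: "0 \<le> s" "s \<le> T"
  shows "integral {0..T} (\<lambda>x. h (s + x)) = integral {0..T} h"
proof -
  have int: "h integrable_on {x..y}" for x y
    using cont by (intro integrable_continuous_interval) (rule continuous_on_subset, auto)
  have "integral {0..T} (\<lambda>x. h (s + x)) = integral {s..T + s} h"
    using integral_shift_Icc_real[of 0 T h s] by (simp add: o_def)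
  also have "\<dots> = integral {s..T} h + integral {T..T + s} h"
    using Henstock_Kurzweil_Integration.integral_combine[of s T "T + s" h] s int by simp
  also have "integral {T..T + s} h = integral {0..s} (\<lambda>x. h (T + x))"
    using integral_shift_Icc_real[of 0 s h T] by (simp add: o_def add.commute)
  also have "(\<lambda>x. h (T + x)) = h"
    using per by (simp add: add.commute)
  also have "integral {s..T} h + integral {0..s} h = integral {0..T} h"
    using Henstock_Kurzweil_Integration.integral_combine[of 0 s T h] s int by simp
  finally show ?thesis .
qed

text \<open>
  Up to the factor \<open>2 * pi\<close> this is the \<open>p\<close>-th power of the integral mean on the circle through \<open>z\<close>.
  With a point of the disk as the argument, in place of a radius, passing from \<open>f\<close> to a rotation or a
  dilation of \<open>f\<close> amounts to moving that point.
\<close>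

definition circle_integral :: "real \<Rightarrow> (complex \<Rightarrow> complex) \<Rightarrow> complex \<Rightarrow> real" where
  "circle_integral p f z = integral {0..2*pi} (\<lambda>\<theta>. norm (f (z * cis \<theta>)) powr p)"

lemma continuous_on_circle_param:
  assumes "continuous_on unit_disk f" "0 < p" "A \<subseteq> unit_disk"
  shows "continuous_on (A \<times> B) (\<lambda>(z, \<theta>). norm (f (z * cis \<theta>)) powr p)"
proof -
  have "continuous_on (A \<times> B) (\<lambda>x. f (fst x * cis (snd x)))"
    using assms by (intro continuous_on_compose2[OF assms(1)] continuous_intros)
      (auto simp: norm_mult)
  then show ?thesis
    using assms(2) by (auto simp: case_prod_unfold intro: continuous_on_norm_powr)
qed

lemma continuous_on_circle:
  assumes "continuous_on unit_disk f" "0 < p" "z \<in> unit_disk"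
  shows "continuous_on B (\<lambda>\<theta>. norm (f (z * cis \<theta>)) powr p)"
  using assms
  by (intro continuous_on_norm_powr continuous_on_compose2[OF assms(1)] continuous_intros)
    (auto simp: norm_mult)

lemma circle_integral_nonneg:
  "0 \<le> circle_integral p f z"
  unfolding circle_integral_def
  by (cases "(\<lambda>\<theta>. norm (f (z * cis \<theta>)) powr p) integrable_on {0..2*pi}")
    (simp_all add: integral_nonneg not_integrable_integral)

lemma continuous_on_circle_integral:
  assumes "continuous_on unit_disk f" "0 < p"
  shows "continuous_on unit_disk (circle_integral p f)"
proof -
  have "continuous_on unit_disk
      (\<lambda>z. integral (cbox 0 (2 * pi)) (\<lambda>\<theta>. norm (f (z * cis \<theta>)) powr p))"
    by (intro integral_continuous_on_param continuous_on_circle_param assms) simp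
  then show ?thesis
    by (simp add: circle_integral_def[abs_def])
qed

lemma circle_integral_rotate:
  assumes "continuous_on unit_disk f" "0 < p" "z \<in> unit_disk"
  shows "circle_integral p f z = circle_integral p f (of_real (norm z))"
proof -
  let ?h = "\<lambda>\<theta>. norm (f (of_real (norm z) * cis \<theta>)) powr p"
  have z: "z = of_real (norm z) * cis (Arg2pi z)"
    using Arg2pi[of z] by (simp add: is_Arg_def cis_conv_exp)
  have "circle_integral p f z = integral {0..2*pi} (\<lambda>\<theta>. ?h (Arg2pi z + \<theta>))"
    unfolding circle_integral_def by (subst z) (simp add: cis_mult mult.assoc)
  also have "\<dots> = integral {0..2*pi} ?h"
  proof (rule integral_periodic_shift)
    show "continuous_on UNIV ?h"
      using assms by (intro continuous_on_circle) auto
    show "?h (\<theta> + 2 * pi) = ?h \<theta>" for \<theta>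
      by (simp add: cis_mult[symmetric])
  qed (use Arg2pi[of z] in auto)
  finally show ?thesis
    by (simp add: circle_integral_def)
qed

text \<open>
  Hardy's theorem that \<open>M\<^sub>p(f, r)\<close> increases with \<open>r\<close>, for every \<open>p > 0\<close>. The Riemann sums
  \<open>\<Sum>k<N. \<bar>f (z * cis (k * c))\<bar>\<^sup>p\<close> with \<open>c = 2 * pi / N\<close> are finite sums of the kind covered by the
  maximum principle, so their value at \<open>a\<close> is at most their value at some \<open>w\<close> with \<open>\<bar>w\<bar> = \<bar>b\<bar>\<close>.
  By uniform continuity they approximate the integral uniformly in \<open>z\<close>, hence also at the point \<open>w\<close>,
  which depends on \<open>N\<close>; and the integral at \<open>w\<close> equals that at \<open>b\<close> by rotation.
\<close>

lemma circle_integral_mono: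
  fixes f :: "complex \<Rightarrow> complex"
  assumes hol: "f holomorphic_on unit_disk" and "0 < p" and ab: "norm a \<le> norm b" "norm b < 1"
  shows "circle_integral p f a \<le> circle_integral p f b"
proof (rule field_le_epsilon)
  fix e :: real
  assume "0 < e"
  have contf: "continuous_on unit_disk f"
    using hol by (rule holomorphic_on_imp_continuous_on)
  define Q where "Q z \<theta> = norm (f (z * cis \<theta>)) powr p" for z \<theta>
  \<comment> \<open>Each of the two Riemann approximations costs \<open>2 * pi * \<eta> = e / 2\<close>.\<close>
  define \<eta> where "\<eta> = e / (4 * pi)"
  have \<eta>: "0 < \<eta>" using \<open>0 < e\<close> by (simp add: \<eta>_def)
  let ?K = "cball 0 (norm b) :: complex set"
  have Ksub: "?K \<subseteq> unit_disk"
    using ab by auto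
  have "continuous_on (?K \<times> {0..2*pi}) (\<lambda>(z, \<theta>). Q z \<theta>)"
    unfolding Q_def by (intro continuous_on_circle_param contf \<open>0 < p\<close> Ksub)
  then have "uniformly_continuous_on (?K \<times> {0..2*pi}) (\<lambda>(z, \<theta>). Q z \<theta>)"
    by (intro compact_uniformly_continuous compact_Times) auto
  then obtain \<delta> where \<delta>: "0 < \<delta>"
    "\<And>x y. x \<in> ?K \<times> {0..2*pi} \<Longrightarrow> y \<in> ?K \<times> {0..2*pi} \<Longrightarrow> dist y x < \<delta> \<Longrightarrow>
      dist (case y of (z, \<theta>) \<Rightarrow> Q z \<theta>) (case x of (z, \<theta>) \<Rightarrow> Q z \<theta>) < \<eta>"
    using \<eta> unfolding uniformly_continuous_on_def by metis
  obtain N :: nat where N: "2 * pi / \<delta> < real N"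
    using reals_Archimedean2 by blast
  then have N0: "0 < real N"
    using \<delta>(1) pi_gt_zero by (meson divide_pos_pos less_trans mult_pos_pos zero_less_numeral)
  define c where "c = 2 * pi / real N"
  have c: "0 \<le> c" "real N * c = 2 * pi" "c < \<delta>"
    using N N0 \<delta>(1) by (auto simp: c_def field_simps)
  have approx: "\<bar>circle_integral p f z - c * (\<Sum>k<N. Q z (real k * c))\<bar> \<le> 2 * pi * \<eta>"
    if "z \<in> ?K" for z
  proof -
    have "\<bar>integral {0..real N * c} (Q z) - c * (\<Sum>k<N. Q z (real k * c))\<bar> \<le> real N * c * \<eta>"
    proof (rule riemann_sum_error)
      show "continuous_on {0..real N * c} (Q z)"
        unfolding Q_def using that Ksub by (intro continuous_on_circle contf \<open>0 < p\<close>) auto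
      show "\<bar>Q z x - Q z y\<bar> \<le> \<eta>"
        if "x \<in> {0..real N * c}" "y \<in> {0..real N * c}" "\<bar>x - y\<bar> \<le> c" for x y
        using \<delta>(2)[of "(z, y)" "(z, x)"] that \<open>z \<in> ?K\<close> c
        by (auto simp: dist_Pair_Pair dist_real_def)
    qed (rule c)
    then show ?thesis
      by (simp add: c circle_integral_def Q_def[abs_def])
  qed
  obtain w where w: "w \<in> frontier ?K"
    "(\<Sum>k\<in>{..<N}. norm (f (a * cis (real k * c))) powr p)
      \<le> (\<Sum>k\<in>{..<N}. norm (f (w * cis (real k * c))) powr p)"
  proof (rule sum_norm_powr_maximum_principle
      [of "{..<N}" p ?K a unit_disk "\<lambda>k z. f (z * cis (real k * c))"])
    show "(\<lambda>z. f (z * cis (real k * c))) holomorphic_on unit_disk" for k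
      by (rule holomorphic_on_compose_gen[OF _ hol, unfolded o_def])
        (auto simp: norm_mult intro!: holomorphic_intros)
  qed (use \<open>0 < p\<close> ab Ksub in auto)
  have w': "norm w = norm b"
    using w(1) by (simp add: frontier_def)
  have "circle_integral p f a \<le> c * (\<Sum>k<N. Q a (real k * c)) + 2 * pi * \<eta>"
    using approx[of a] ab by simp
  also have "\<dots> \<le> c * (\<Sum>k<N. Q w (real k * c)) + 2 * pi * \<eta>"
    using w(2) c(1) by (simp add: Q_def mult_left_mono)
  also have "\<dots> \<le> circle_integral p f w + 4 * pi * \<eta>"
    using approx[of w] w' by simp
  also have "circle_integral p f w = circle_integral p f b"
    using circle_integral_rotate[OF contf \<open>0 < p\<close>, of w]
      circle_integral_rotate[OF contf \<open>0 < p\<close>, of b] w' ab by simp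
  finally show "circle_integral p f a \<le> circle_integral p f b + e"
    by (simp add: \<eta>_def)
qed

section \<open>The mixed norm space\<close>

lemma mixed_integrand_eq:
  assumes "continuous_on unit_disk f" "0 < p" "0 \<le> r" "r < 1"
  shows "mixed_integrand p \<phi> f r =
    circle_integral p f (of_real r) / (2 * pi) * (\<phi> r powr p / (1 - r)) * r"
proof -
  let ?g = "\<lambda>\<theta>. norm (f (of_real r * cis \<theta>)) powr p"
  have "continuous_on {0..2*pi} ?g"
    using assms by (intro continuous_on_circle) auto
  then have "set_integrable lborel {0..2*pi} ?g"
    by (intro borel_integrable_atLeastAtMost')
  then have "(LBINT \<theta>:{0..2*pi}. ?g \<theta>) = circle_integral p f (of_real r)"
    unfolding circle_integral_def by (rule set_borel_integral_eq_integral(2))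
  then show ?thesis
    using assms circle_integral_nonneg[of p f "of_real r"]
    by (simp add: mixed_integrand_def integral_mean_def powr_powr)
qed

lemma mixed_integrand_nonneg:
  "0 \<le> r \<Longrightarrow> r < 1 \<Longrightarrow> 0 \<le> mixed_integrand p \<phi> f r"
  by (simp add: mixed_integrand_def)

lemma continuous_on_mixed_integrand:
  assumes "continuous_on unit_disk f" "0 < p" "continuous_on {0..<1} \<phi>"
    "\<And>r. r \<in> {0..<1} \<Longrightarrow> 0 < \<phi> r"
  shows "continuous_on {0..<1} (mixed_integrand p \<phi> f)"
proof -
  have "continuous_on {0..<1::real} (\<lambda>r. circle_integral p f (of_real r))"
    by (rule continuous_on_compose2[OF continuous_on_circle_integral[OF assms(1,2)]])
      (auto intro!: continuous_intros)
  then have "continuous_on {0..<1}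
      (\<lambda>r. circle_integral p f (of_real r) / (2 * pi) * (\<phi> r powr p / (1 - r)) * r)"
    using assms(2-4) by (intro continuous_intros) (force simp: less_imp_neq)+
  then show ?thesis
    by (rule continuous_on_eq) (use assms in \<open>simp add: mixed_integrand_eq\<close>)
qed

text \<open>
  Near \<open>1\<close> the bound is the decrease of \<open>\<phi>(r) / (1 - r) powr s\<close>, and on the remaining compact interval
  it is the boundedness of this continuous quotient. It makes the weight \<open>\<phi>(r)\<^sup>p / (1 - r)\<close> integrable.
\<close>

lemma normal_weight_le_powr:
  assumes "normal_weight \<phi>"
  obtains s K where "0 < s" "\<And>r. r \<in> {0..<1} \<Longrightarrow> \<phi> r \<le> K * (1 - r) powr s"
proof -
  obtain s t \<delta> where s: "0 < s" and \<delta>: "0 \<le> \<delta>" "\<delta> < 1"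
    and anti: "antimono_on {\<delta>..<1} (\<lambda>r. \<phi> r / (1 - r) powr s)"
    using assms unfolding normal_weight_def by blast
  define q where "q r = \<phi> r / (1 - r) powr s" for r
  have "continuous_on {0..\<delta>} \<phi>"
    using assms \<delta> unfolding normal_weight_def by (auto intro: continuous_on_subset)
  then have "continuous_on {0..\<delta>} q"
    unfolding q_def using \<delta> by (intro continuous_intros) auto
  then obtain m where m: "\<And>r. r \<in> {0..\<delta>} \<Longrightarrow> q r \<le> q m"
    using continuous_attains_sup[of "{0..\<delta>}" q] \<delta>(1)
    by (metis atLeastatMost_empty_iff2 compact_Icc not_le)
  have q: "q r \<le> q m" if "r \<in> {0..<1}" for r
  proof (cases "r \<le> \<delta>")
    case False
    then have "q r \<le> q \<delta>"
      using anti that \<delta> by (auto simp: monotone_on_def q_def)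
    with m[of \<delta>] \<delta> show ?thesis by simp
  qed (use m that in auto)
  have "\<phi> r \<le> q m * (1 - r) powr s" if "r \<in> {0..<1}" for r
    using q[OF that] that by (simp add: q_def[of r] pos_divide_le_eq)
  with s show thesis
    using that by blast
qed

lemma set_integrable_one_minus_powr:
  fixes a :: real
  assumes "-1 < a"
  shows "set_integrable lborel {0..<1} (\<lambda>r. (1 - r) powr a)"
proof -
  have "(\<lambda>x::real. x powr a) absolutely_integrable_on {0..1}"
    using integrable_on_powr_from_0[OF assms, of 1]
    by (intro nonnegative_absolutely_integrable_1) auto
  then have "integrable lborel (\<lambda>x. indicator {0..1} x *\<^sub>R (x powr a))"
    unfolding set_integrable_def by (subst (asm) integrable_completion) auto
  from lborel_integrable_real_affine[OF this, of "-1" 1]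
  have "integrable lborel (\<lambda>x. indicator {0..1} (1 - x) *\<^sub>R ((1 - x) powr a))"
    by simp
  also have "(\<lambda>x::real. indicator {0..1} (1 - x) :: real) = indicator {0..1}"
    by (auto simp: indicator_def)
  finally have "set_integrable lborel {0..1} (\<lambda>r. (1 - r) powr a)"
    by (simp add: set_integrable_def indicator_def)
  then show ?thesis
    by (rule set_integrable_subset) auto
qed

lemma mixed_integral_nonneg: "0 \<le> (LBINT r:{0..<1}. mixed_integrand p \<phi> f r)"
  unfolding set_lebesgue_integral_def
  by (intro Bochner_Integration.integral_nonneg) (auto simp: indicator_def mixed_integrand_nonneg)

lemma mixed_norm_space_memI:
  assumes "f holomorphic_on unit_disk" "0 < p" "normal_weight \<phi>"
    and g: "set_integrable lborel {0..<1} g"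
    and le: "\<And>r. r \<in> {0..<1} \<Longrightarrow> mixed_integrand p \<phi> f r \<le> g r"
  shows "f \<in> mixed_norm_space p \<phi>"
proof -
  have "continuous_on {0..<1} (mixed_integrand p \<phi> f)"
    using assms by (intro continuous_on_mixed_integrand holomorphic_on_imp_continuous_on)
      (auto simp: normal_weight_def)
  then have "set_borel_measurable lborel {0..<1} (mixed_integrand p \<phi> f)"
    unfolding set_borel_measurable_def
    using borel_measurable_continuous_on_indicator[of "{0..<1}" "mixed_integrand p \<phi> f"] by simp
  moreover have "norm (mixed_integrand p \<phi> f r) \<le> norm (g r)" if "r \<in> {0..<1}" for r
    using le[OF that] mixed_integrand_nonneg[of r p \<phi> f] that by simp
  ultimately have "set_integrable lborel {0..<1} (mixed_integrand p \<phi> f)"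
    using set_integrable_bound[OF g, of "mixed_integrand p \<phi> f"] by simp
  with assms show ?thesis
    by (simp add: mixed_norm_space_def)
qed

text \<open>
  This supplies the test functions \<open>1\<close> and \<open>z\<close>. If \<open>\<bar>f\<bar> \<le> B\<close> then the integrand of the mixed norm is at
  most \<open>B\<^sup>p * \<phi>(r)\<^sup>p / (1 - r)\<close>, which is \<open>O((1 - r) powr (s * p - 1))\<close> with \<open>s * p - 1 > -1\<close>.
\<close>

lemma bounded_holomorphic_in_mixed_norm_space:
  assumes "f holomorphic_on unit_disk" "0 < p" "normal_weight \<phi>"
    and bound: "\<And>z. z \<in> unit_disk \<Longrightarrow> norm (f z) \<le> B"
  shows "f \<in> mixed_norm_space p \<phi>"
proof -
  obtain s K where s: "0 < s" and K: "\<And>r. r \<in> {0..<1} \<Longrightarrow> \<phi> r \<le> K * (1 - r) powr s"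
    using normal_weight_le_powr[OF assms(3)] by blast
  have pos: "0 < \<phi> r" if "r \<in> {0..<1}" for r
    using assms(3) that by (auto simp: normal_weight_def)
  have contf: "continuous_on unit_disk f"
    using assms(1) by (rule holomorphic_on_imp_continuous_on)
  have "0 < K"
    using K[of 0] pos[of 0] by simp
  define g where "g r = B powr p * K powr p * (1 - r) powr (s * p - 1)" for r :: real
  show ?thesis
  proof (rule mixed_norm_space_memI[OF assms(1-3)])
    show "set_integrable lborel {0..<1} g"
      unfolding g_def using s \<open>0 < p\<close>
      by (intro set_integrable_mult_right set_integrable_one_minus_powr)
        (simp add: less_le_trans[OF _ mult_nonneg_nonneg])
    fix r :: real
    assume r: "r \<in> {0..<1}"
    let ?c = "circle_integral p f (of_real r)"
    have "?c \<le> B powr p * (2 * pi - 0)"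
    proof -
      have "norm (integral {0..2*pi} (\<lambda>\<theta>. norm (f (of_real r * cis \<theta>)) powr p))
          \<le> B powr p * (2 * pi - 0)"
      proof (rule integral_bound)
        show "continuous_on {0..2*pi} (\<lambda>\<theta>. norm (f (of_real r * cis \<theta>)) powr p)"
          using r by (intro continuous_on_circle contf \<open>0 < p\<close>) auto
        show "norm (norm (f (of_real r * cis \<theta>)) powr p) \<le> B powr p" for \<theta>
          using bound[of "of_real r * cis \<theta>"] r \<open>0 < p\<close>
          by (auto simp: norm_mult intro!: powr_mono2)
      qed simp
      then show ?thesis
        by (simp add: circle_integral_def)
    qed
    then have c: "?c / (2 * pi) \<le> B powr p"
      by (simp add: field_simps)
    have "\<phi> r powr p \<le> (K * (1 - r) powr s) powr p"
      using K[OF r] pos[OF r] \<open>0 < p\<close> by (intro powr_mono2) auto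
    also have "\<dots> = K powr p * (1 - r) powr (s * p)"
      using \<open>0 < K\<close> by (simp add: powr_mult powr_powr)
    finally have "\<phi> r powr p / (1 - r) \<le> K powr p * (1 - r) powr (s * p) / (1 - r)"
      using r by (intro divide_right_mono) auto
    also have "\<dots> = K powr p * (1 - r) powr (s * p - 1)"
      using r by (simp add: powr_diff)
    finally have w: "\<phi> r powr p / (1 - r) \<le> K powr p * (1 - r) powr (s * p - 1)" .
    have "mixed_integrand p \<phi> f r = ?c / (2 * pi) * (\<phi> r powr p / (1 - r)) * r"
      using r by (intro mixed_integrand_eq contf \<open>0 < p\<close>) auto
    also have "\<dots> \<le> B powr p * (K powr p * (1 - r) powr (s * p - 1)) * 1"
      using c w r circle_integral_nonneg[of p f "of_real r"]
      by (intro mult_mono) auto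
    finally show "mixed_integrand p \<phi> f r \<le> g r"
      by (simp add: g_def)
  qed
qed

section \<open>Dilations converge in the mixed norm\<close>

text \<open>
  A substitute for the triangle inequality that serves all \<open>p > 0\<close> alike.
\<close>

lemma norm_diff_powr_le:
  fixes x y :: "'a::real_normed_vector" and p :: real
  assumes "0 < p"
  shows "norm (x - y) powr p \<le> 2 powr p * (norm x powr p + norm y powr p)"
proof -
  let ?m = "max (norm x) (norm y)"
  have "norm (x - y) \<le> 2 * ?m"
    using norm_triangle_ineq4[of x y] by linarith
  then have "norm (x - y) powr p \<le> (2 * ?m) powr p"
    using assms by (intro powr_mono2) auto
  also have "\<dots> = 2 powr p * ?m powr p"
    by (simp add: powr_mult)
  also have "?m powr p \<le> norm x powr p + norm y powr p"
    by (auto simp: max_def)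
  finally show ?thesis
    by simp
qed

lemma holomorphic_on_dilation:
  assumes "f holomorphic_on unit_disk" "0 \<le> \<rho>" "\<rho> \<le> (1::real)"
  shows "(\<lambda>z. f (of_real \<rho> * z)) holomorphic_on unit_disk"
proof (rule holomorphic_on_compose_gen[OF _ assms(1), unfolded o_def])
  show "(\<lambda>z. of_real \<rho> * z) ` unit_disk \<subseteq> unit_disk"
    using assms(2,3) by (auto simp: norm_mult intro: le_less_trans[OF mult_left_le_one_le[OF norm_ge_zero]])
qed (intro holomorphic_intros)

text \<open>
  The domination needed for letting \<open>\<rho> \<rightarrow> 1\<close> under the integral over \<open>r\<close>: the bound does not depend on
  \<open>\<rho>\<close> because the mean of the dilated function is the mean of \<open>f\<close> on a smaller circle.
\<close>

lemma circle_integral_diff_dilation_le: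
  assumes hol: "f holomorphic_on unit_disk" and "0 < p" "0 \<le> \<rho>" "\<rho> \<le> 1" "z \<in> unit_disk"
  shows "circle_integral p (\<lambda>w. f w - f (of_real \<rho> * w)) z
    \<le> 2 powr p * 2 * circle_integral p f z"
proof -
  let ?g = "\<lambda>w. f (of_real \<rho> * w)"
  have cont: "continuous_on unit_disk f" "continuous_on unit_disk ?g"
    using hol holomorphic_on_dilation[OF hol assms(3,4)]
    by (auto intro: holomorphic_on_imp_continuous_on)
  note int = integrable_continuous_interval[OF continuous_on_circle[OF _ \<open>0 < p\<close> \<open>z \<in> unit_disk\<close>]]
  have "circle_integral p (\<lambda>w. f w - ?g w) z
    \<le> integral {0..2*pi}
        (\<lambda>\<theta>. 2 powr p * (norm (f (z * cis \<theta>)) powr p + norm (?g (z * cis \<theta>)) powr p))"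
    unfolding circle_integral_def
  proof (rule integral_le)
    show "(\<lambda>\<theta>. 2 powr p * (norm (f (z * cis \<theta>)) powr p + norm (?g (z * cis \<theta>)) powr p))
        integrable_on {0..2*pi}"
      using integrable_on_cmult_left[OF integrable_add[OF int[OF cont(1)] int[OF cont(2)]]]
      by simp
    show "(\<lambda>\<theta>. norm (f (z * cis \<theta>) - ?g (z * cis \<theta>)) powr p) integrable_on {0..2*pi}"
      by (intro int[of "\<lambda>w. f w - ?g w"] continuous_on_diff cont)
  qed (rule norm_diff_powr_le[OF \<open>0 < p\<close>])
  also have "\<dots> = 2 powr p * (circle_integral p f z + circle_integral p ?g z)"
    unfolding circle_integral_def
    by (subst integral_add[symmetric]) (auto intro: int[OF cont(1)] int[OF cont(2)])
  also have "circle_integral p ?g z = circle_integral p f (of_real \<rho> * z)"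
    by (simp add: circle_integral_def mult.assoc)
  also have "\<dots> \<le> circle_integral p f z"
    using assms by (intro circle_integral_mono hol)
      (auto simp: norm_mult intro: mult_left_le_one_le)
  finally show ?thesis
    by (simp add: algebra_simps)
qed

text \<open>
  For fixed \<open>z\<close> the integral is a continuous function of \<open>\<rho> \<in> [0, 1]\<close> that vanishes at \<open>\<rho> = 1\<close>.
\<close>

lemma circle_integral_diff_dilation_tendsto_0:
  assumes cont: "continuous_on unit_disk f" and "0 < p" "z \<in> unit_disk"
    and \<rho>: "\<rho> \<longlonglongrightarrow> 1" "\<And>n. \<rho> n \<in> {0..1::real}"
  shows "(\<lambda>n. circle_integral p (\<lambda>w. f w - f (of_real (\<rho> n) * w)) z) \<longlonglongrightarrow> 0"
proof -
  let ?I = "\<lambda>t::real. circle_integral p (\<lambda>w. f w - f (of_real t * w)) z"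
  have sub: "t * norm z < 1" if "0 \<le> t" "t \<le> 1" for t
    using that assms(3) by (auto intro: le_less_trans[OF mult_left_le_one_le[OF norm_ge_zero]])
  have c: "continuous_on ({0..1::real} \<times> cbox 0 (2*pi))
      (\<lambda>x. f (z * cis (snd x)) - f (of_real (fst x) * (z * cis (snd x))))"
    using assms(3) sub
    by (intro continuous_on_compose2[OF cont] continuous_intros) (auto simp: norm_mult)
  have "continuous_on {0..1} (\<lambda>t::real. integral (cbox 0 (2*pi))
      (\<lambda>\<theta>. norm (f (z * cis \<theta>) - f (of_real t * (z * cis \<theta>))) powr p))"
    using continuous_on_norm_powr[OF c \<open>0 < p\<close>]
    by (intro integral_continuous_on_param) (simp add: case_prod_unfold)
  then have "continuous_on {0..1} ?I"
    by (simp add: circle_integral_def)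
  from continuous_on_tendsto_compose[OF this \<rho>(1)] \<rho>(2)
  have "(\<lambda>n. ?I (\<rho> n)) \<longlonglongrightarrow> ?I 1"
    by auto
  also have "?I 1 = 0"
    by (simp add: circle_integral_def)
  finally show ?thesis .
qed

text \<open>
  The dilations \<open>f(\<rho> z)\<close> with \<open>\<rho> < 1\<close> are bounded with bounded derivative, so this density statement
  reduces questions about the whole space to such functions, in the role usually given to
  polynomials.
\<close>

lemma mixed_norm_diff_dilation:
  fixes \<rho> :: "nat \<Rightarrow> real"
  assumes f: "f \<in> mixed_norm_space p \<phi>" and "0 < p" "normal_weight \<phi>"
    and \<rho>: "\<rho> \<longlonglongrightarrow> 1" "\<And>n. \<rho> n \<in> {0..1}"
  shows "(\<lambda>z. f z - f (of_real (\<rho> n) * z)) \<in> mixed_norm_space p \<phi>"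
    and "(\<lambda>n. mixed_norm p \<phi> (\<lambda>z. f z - f (of_real (\<rho> n) * z))) \<longlonglongrightarrow> 0"
proof -
  define d where "d n z = f z - f (of_real (\<rho> n) * z)" for n z
  have hol: "f holomorphic_on unit_disk"
    and int: "set_integrable lborel {0..<1} (mixed_integrand p \<phi> f)"
    using f by (auto simp: mixed_norm_space_def)
  have contf: "continuous_on unit_disk f"
    using hol by (rule holomorphic_on_imp_continuous_on)
  have hold: "d n holomorphic_on unit_disk" for n
    unfolding d_def using hol holomorphic_on_dilation[OF hol, of "\<rho> n"] \<rho>(2)[of n]
    by (intro holomorphic_intros) auto
  have eq: "mixed_integrand p \<phi> (d n) r =
      circle_integral p (d n) (of_real r) / (2 * pi) * (\<phi> r powr p / (1 - r)) * r"
    if "r \<in> {0..<1}" for n r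
    using that by (intro mixed_integrand_eq holomorphic_on_imp_continuous_on hold \<open>0 < p\<close>) auto
  define C where "C = 2 powr p * (2::real)"
  have le: "mixed_integrand p \<phi> (d n) r \<le> C * mixed_integrand p \<phi> f r"
    if r: "r \<in> {0..<1}" for n r
  proof -
    have "circle_integral p (d n) (of_real r) \<le> C * circle_integral p f (of_real r)"
      unfolding C_def d_def using r \<rho>(2)[of n]
      by (intro circle_integral_diff_dilation_le hol \<open>0 < p\<close>) auto
    then have "circle_integral p (d n) (of_real r) * (\<phi> r powr p / (1 - r) * r / (2 * pi))
        \<le> C * circle_integral p f (of_real r) * (\<phi> r powr p / (1 - r) * r / (2 * pi))"
      using r by (intro mult_right_mono) auto
    then show ?thesis
      using r contf \<open>0 < p\<close> by (simp add: eq mixed_integrand_eq mult_ac)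
  qed
  have intC: "set_integrable lborel {0..<1} (\<lambda>r. C * mixed_integrand p \<phi> f r)"
    using int by (rule set_integrable_mult_right)
  have mem: "d n \<in> mixed_norm_space p \<phi>" for n
    using mixed_norm_space_memI[OF hold \<open>0 < p\<close> \<open>normal_weight \<phi>\<close> intC le] .
  then show "(\<lambda>z. f z - f (of_real (\<rho> n) * z)) \<in> mixed_norm_space p \<phi>"
    by (simp add: d_def[abs_def])
  have "(\<lambda>n. LBINT r:{0..<1}. mixed_integrand p \<phi> (d n) r) \<longlonglongrightarrow> (LBINT r:{0..<1::real}. 0)"
    unfolding set_lebesgue_integral_def
  proof (rule integral_dominated_convergence
      [where w = "\<lambda>r. indicator {0..<1} r *\<^sub>R (C * mixed_integrand p \<phi> f r)"])
    show "integrable lborel (\<lambda>r. indicator {0..<1} r *\<^sub>R (C * mixed_integrand p \<phi> f r))"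
      using intC by (simp add: set_integrable_def)
    show "(\<lambda>r. indicator {0..<1} r *\<^sub>R mixed_integrand p \<phi> (d n) r) \<in> borel_measurable lborel" for n
      using mem[of n] unfolding mixed_norm_space_def set_integrable_def
      by (auto dest: borel_measurable_integrable)
    show "AE r in lborel. (\<lambda>n. indicator {0..<1} r *\<^sub>R mixed_integrand p \<phi> (d n) r)
        \<longlonglongrightarrow> indicator {0..<1} r *\<^sub>R 0"
    proof (intro AE_I2)
      fix r :: real
      show "(\<lambda>n. indicator {0..<1} r *\<^sub>R mixed_integrand p \<phi> (d n) r)
        \<longlonglongrightarrow> indicator {0..<1} r *\<^sub>R 0"
      proof (cases "r \<in> {0..<1}")
        case True
        have "(\<lambda>n. circle_integral p (d n) (of_real r)) \<longlonglongrightarrow> 0"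
          unfolding d_def using True
          by (intro circle_integral_diff_dilation_tendsto_0 contf \<rho> \<open>0 < p\<close>) auto
        then have "(\<lambda>n. circle_integral p (d n) (of_real r) / (2 * pi)
            * (\<phi> r powr p / (1 - r)) * r) \<longlonglongrightarrow> 0"
          by (auto intro!: tendsto_mult_left_zero tendsto_divide_zero)
        then show ?thesis
          using True by (simp add: eq)
      qed simp
    qed
    show "AE r in lborel. norm (indicator {0..<1} r *\<^sub>R mixed_integrand p \<phi> (d n) r)
        \<le> indicator {0..<1} r *\<^sub>R (C * mixed_integrand p \<phi> f r)" for n
      using le mixed_integrand_nonneg by (intro AE_I2) (auto simp: indicator_def)
  qed simp
  then have "(\<lambda>n. LBINT r:{0..<1}. mixed_integrand p \<phi> (d n) r) \<longlonglongrightarrow> 0"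
    by (simp add: set_lebesgue_integral_def)
  then have "(\<lambda>n. mixed_norm p \<phi> (d n)) \<longlonglongrightarrow> 0"
    unfolding mixed_norm_def using \<open>0 < p\<close> mixed_integral_nonneg
    by (intro tendsto_zero_powrI[OF _ tendsto_const]) auto
  then show "(\<lambda>n. mixed_norm p \<phi> (\<lambda>z. f z - f (of_real (\<rho> n) * z))) \<longlonglongrightarrow> 0"
    by (simp add: d_def[abs_def])
qed

section \<open>Weighted composition operators\<close>

lemma integral_mean_powr:
  assumes "0 < p"
  shows "integral_mean p f r powr p =
    1 / (2 * pi) * (LBINT \<theta>:{0..2*pi}. norm (f (of_real r * cis \<theta>)) powr p)"
proof -
  have "0 \<le> (LBINT \<theta>:{0..2*pi}. norm (f (of_real r * cis \<theta>)) powr p)"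
    unfolding set_lebesgue_integral_def by (intro Bochner_Integration.integral_nonneg) simp
  then show ?thesis
    using assms by (simp add: integral_mean_def powr_powr)
qed

lemma mixed_integrand_cmult:
  assumes "0 < p"
  shows "mixed_integrand p \<phi> (\<lambda>z. c * f z) r = norm c powr p * mixed_integrand p \<phi> f r"
  using assms by (simp add: mixed_integrand_def integral_mean_powr norm_mult powr_mult)

lemma mixed_norm_space_cmult:
  assumes "f \<in> mixed_norm_space p \<phi>" "0 < p"
  shows "(\<lambda>z. c * f z) \<in> mixed_norm_space p \<phi>"
proof -
  have "mixed_integrand p \<phi> (\<lambda>z. c * f z) = (\<lambda>r. norm c powr p * mixed_integrand p \<phi> f r)"
    using assms(2) by (intro ext mixed_integrand_cmult)
  then show ?thesis
    using assms by (auto simp: mixed_norm_space_def intro!: holomorphic_intros)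
qed

lemma mixed_norm_cmult:
  assumes "0 < p"
  shows "mixed_norm p \<phi> (\<lambda>z. c * f z) = norm c * mixed_norm p \<phi> f"
  using assms mixed_integral_nonneg[of p \<phi> f]
  by (simp add: mixed_norm_def mixed_integrand_cmult powr_mult powr_powr)

lemma has_field_derivative_weighted_comp:
  assumes "analytic_self_map \<psi>" "u holomorphic_on unit_disk" "f holomorphic_on unit_disk"
    and "z \<in> unit_disk"
  shows "(weighted_comp u \<psi> f has_field_derivative
    deriv u z * f (\<psi> z) + u z * (deriv f (\<psi> z) * deriv \<psi> z)) (at z)"
proof -
  have "\<psi> z \<in> unit_disk" "\<psi> holomorphic_on unit_disk"
    using assms unfolding analytic_self_map_def by blast+
  then have "(f has_field_derivative deriv f (\<psi> z)) (at (\<psi> z))"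
    "(\<psi> has_field_derivative deriv \<psi> z) (at z)" "(u has_field_derivative deriv u z) (at z)"
    using assms holomorphic_derivI[OF _ open_ball] by auto
  then show ?thesis
    unfolding weighted_comp_def
    by (auto intro!: derivative_eq_intros DERIV_chain2 simp: mult_ac)
qed

lemma eventually_to_unit_circle_in_disk: "\<forall>\<^sub>F z in to_unit_circle. z \<in> unit_disk"
  unfolding to_unit_circle_def
  using eventually_filtercomapI[OF eventually_at_left_real[of "0::real" 1], of norm]
  by (auto elim: eventually_mono)

lemma one_minus_norm_square_pos: "z \<in> unit_disk \<Longrightarrow> 0 < 1 - (norm z)\<^sup>2"
  by (simp add: abs_square_less_1)

lemma one_minus_norm_square_mult_nonneg:
  "z \<in> unit_disk \<Longrightarrow> 0 \<le> (1 - (norm z)\<^sup>2) * norm w"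
  using one_minus_norm_square_pos[of z] by simp

text \<open>
  The derivative of \<open>u * (f \<circ> \<psi>)\<close> is \<open>u' * (f \<circ> \<psi>) + u * \<psi>' * (f' \<circ> \<psi>)\<close>, and the bounds on \<open>f\<close> and \<open>f'\<close>
  turn the two hypotheses on \<open>u\<close> and \<open>u * \<psi>'\<close> into a bound for each summand.
\<close>

lemma weighted_comp_deriv_tendsto_0:
  assumes \<psi>: "analytic_self_map \<psi>" and u: "u holomorphic_on unit_disk"
    and f: "f holomorphic_on unit_disk"
    and bounds: "\<And>w. w \<in> unit_disk \<Longrightarrow> norm (f w) \<le> A"
      "\<And>w. w \<in> unit_disk \<Longrightarrow> norm (deriv f w) \<le> B"
    and u0: "((\<lambda>z. (1 - (norm z)\<^sup>2) * norm (deriv u z)) \<longlongrightarrow> 0) to_unit_circle"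
    and u\<psi>0: "((\<lambda>z. (1 - (norm z)\<^sup>2) * norm (u z * deriv \<psi> z)) \<longlongrightarrow> 0) to_unit_circle"
  shows "((\<lambda>z. (1 - (norm z)\<^sup>2) * norm (deriv (weighted_comp u \<psi> f) z)) \<longlongrightarrow> 0) to_unit_circle"
proof (rule tendsto_sandwich)
  show "\<forall>\<^sub>F z in to_unit_circle. 0 \<le> (1 - (norm z)\<^sup>2) * norm (deriv (weighted_comp u \<psi> f) z)"
    using eventually_to_unit_circle_in_disk
    by eventually_elim (rule one_minus_norm_square_mult_nonneg)
  show "\<forall>\<^sub>F z in to_unit_circle. (1 - (norm z)\<^sup>2) * norm (deriv (weighted_comp u \<psi> f) z)
      \<le> A * ((1 - (norm z)\<^sup>2) * norm (deriv u z)) + B * ((1 - (norm z)\<^sup>2) * norm (u z * deriv \<psi> z))"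
    using eventually_to_unit_circle_in_disk
  proof eventually_elim
    case (elim z)
    then have \<psi>z: "\<psi> z \<in> unit_disk"
      using \<psi> unfolding analytic_self_map_def by blast
    have "norm (deriv (weighted_comp u \<psi> f) z)
        = norm (deriv u z * f (\<psi> z) + u z * (deriv f (\<psi> z) * deriv \<psi> z))"
      using DERIV_imp_deriv[OF has_field_derivative_weighted_comp[OF \<psi> u f elim]] by simp
    also have "\<dots> \<le> norm (f (\<psi> z)) * norm (deriv u z)
        + norm (deriv f (\<psi> z)) * norm (u z * deriv \<psi> z)"
      using norm_triangle_ineq[of "deriv u z * f (\<psi> z)" "u z * (deriv f (\<psi> z) * deriv \<psi> z)"]
      by (simp add: norm_mult mult_ac)
    also have "\<dots> \<le> A * norm (deriv u z) + B * norm (u z * deriv \<psi> z)"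
      using bounds[OF \<psi>z] by (intro add_mono mult_right_mono) auto
    finally have "(1 - (norm z)\<^sup>2) * norm (deriv (weighted_comp u \<psi> f) z)
        \<le> (1 - (norm z)\<^sup>2) * (A * norm (deriv u z) + B * norm (u z * deriv \<psi> z))"
      using one_minus_norm_square_pos[OF elim] by (intro mult_left_mono) auto
    then show ?case
      by (simp add: algebra_simps)
  qed
  show "((\<lambda>z. A * ((1 - (norm z)\<^sup>2) * norm (deriv u z))
      + B * ((1 - (norm z)\<^sup>2) * norm (u z * deriv \<psi> z))) \<longlongrightarrow> 0) to_unit_circle"
    using u0 u\<psi>0 by (auto intro!: tendsto_add_zero tendsto_mult_right_zero)
qed simp

lemma dilation_bounds:
  assumes "f holomorphic_on unit_disk" "0 \<le> \<rho>" "\<rho> < (1::real)"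
  obtains A B where "\<And>w. w \<in> unit_disk \<Longrightarrow> norm (f (of_real \<rho> * w)) \<le> A"
    "\<And>w. w \<in> unit_disk \<Longrightarrow> norm (deriv (\<lambda>w. f (of_real \<rho> * w)) w) \<le> B"
proof -
  let ?K = "cball 0 \<rho> :: complex set"
  have sub: "?K \<subseteq> unit_disk"
    using assms by auto
  have inK: "of_real \<rho> * w \<in> ?K" if "w \<in> unit_disk" for w
    using that assms by (auto simp: norm_mult intro: mult_right_le_one_le)
  have "deriv f holomorphic_on unit_disk"
    by (rule holomorphic_deriv[OF assms(1) open_ball])
  with assms(1) have "continuous_on ?K f" "continuous_on ?K (deriv f)"
    by (meson continuous_on_subset holomorphic_on_imp_continuous_on sub)+
  then have "bounded (f ` ?K)" "bounded (deriv f ` ?K)"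
    by (auto intro!: compact_imp_bounded compact_continuous_image)
  then obtain A B where AB: "\<And>w. w \<in> ?K \<Longrightarrow> norm (f w) \<le> A" "\<And>w. w \<in> ?K \<Longrightarrow> norm (deriv f w) \<le> B"
    unfolding bounded_iff by blast
  show thesis
  proof
    show "norm (f (of_real \<rho> * w)) \<le> A" if "w \<in> unit_disk" for w
      using AB(1) inK[OF that] by blast
    show "norm (deriv (\<lambda>w. f (of_real \<rho> * w)) w) \<le> B" if w: "w \<in> unit_disk" for w
    proof -
      have "(f has_field_derivative deriv f (of_real \<rho> * w)) (at (of_real \<rho> * w))"
        using holomorphic_derivI[OF assms(1) open_ball] inK[OF w] sub by blast
      then have "((\<lambda>w. f (of_real \<rho> * w)) has_field_derivative
          deriv f (of_real \<rho> * w) * of_real \<rho>) (at w)"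
        by (rule DERIV_chain2) (auto intro!: derivative_eq_intros)
      then have "norm (deriv (\<lambda>w. f (of_real \<rho> * w)) w) = norm (deriv f (of_real \<rho> * w)) * \<rho>"
        using assms(2) by (simp add: DERIV_imp_deriv norm_mult)
      also have "\<dots> \<le> norm (deriv f (of_real \<rho> * w))"
        using assms by (intro mult_right_le_one_le) auto
      also have "\<dots> \<le> B"
        using AB(2) inK[OF w] by blast
      finally show ?thesis .
    qed
  qed
qed

text \<open>
  Boundedness is stated for bounded sets; scaling \<open>f\<close> into the unit ball gives an estimate that is
  linear in \<open>e\<close>. Passing through an upper bound \<open>e > 0\<close> of the norm, instead of dividing by the norm,
  covers functions of norm zero.
\<close>

lemma bounded_operator_into_bloch_deriv_le:
  assumes \<psi>: "analytic_self_map \<psi>" and u: "u holomorphic_on unit_disk" and "0 < p"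
    and bdd: "bounded_operator (mixed_norm_space p \<phi>) (mixed_norm p \<phi>)
           bloch_space bloch_norm (weighted_comp u \<psi>)"
  obtains C where "\<And>f e z. f \<in> mixed_norm_space p \<phi> \<Longrightarrow> mixed_norm p \<phi> f \<le> e \<Longrightarrow> 0 < e \<Longrightarrow>
      z \<in> unit_disk \<Longrightarrow> (1 - (norm z)\<^sup>2) * norm (deriv (weighted_comp u \<psi> f) z) \<le> C * e"
proof -
  let ?T = "weighted_comp u \<psi>"
  let ?S = "{g \<in> mixed_norm_space p \<phi>. mixed_norm p \<phi> g \<le> 1}"
  have imp: "(\<exists>C. \<forall>f\<in>?S. mixed_norm p \<phi> f \<le> C) \<longrightarrow> (\<exists>C. \<forall>g\<in>?T ` ?S. bloch_norm g \<le> C)"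
    using bdd[unfolded bounded_operator_def, THEN conjunct2, THEN spec, of ?S] by simp
  have "\<exists>C. \<forall>f\<in>?S. mixed_norm p \<phi> f \<le> C"
    by (rule exI[of _ 1]) simp
  from mp[OF imp this] obtain C where "\<forall>g\<in>?T ` ?S. bloch_norm g \<le> C" ..
  then have C: "bloch_norm (?T g) \<le> C" if "g \<in> ?S" for g
    using that by (rule bspec[OF _ imageI])
  have "(1 - (norm z)\<^sup>2) * norm (deriv (?T f) z) \<le> C * e"
    if f: "f \<in> mixed_norm_space p \<phi>" "mixed_norm p \<phi> f \<le> e" "0 < e" and z: "z \<in> unit_disk"
    for f e z
  proof -
    define g where "g = (\<lambda>z. of_real (1 / e) * f z)"
    have g: "g \<in> ?S"
      using f \<open>0 < p\<close> by (simp add: g_def mixed_norm_space_cmult mixed_norm_cmult divide_le_eq_1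
          norm_divide del: of_real_divide)
    have Tg: "?T g \<in> bloch_space"
      using bdd g by (auto simp: bounded_operator_def)
    have "(?T f has_field_derivative deriv (?T f) z) (at z)"
      using has_field_derivative_weighted_comp[OF \<psi> u _ z, of f] f
      by (metis (mono_tags, lifting) DERIV_imp_deriv mem_Collect_eq mixed_norm_space_def)
    then have "((\<lambda>z. of_real (1 / e) * ?T f z) has_field_derivative
        of_real (1 / e) * deriv (?T f) z) (at z)"
      by (rule DERIV_cmult)
    moreover have "?T g = (\<lambda>z. of_real (1 / e) * ?T f z)"
      by (simp add: g_def weighted_comp_def mult_ac)
    ultimately have "deriv (?T g) z = of_real (1 / e) * deriv (?T f) z"
      by (simp add: DERIV_imp_deriv)
    then have "(1 - (norm z)\<^sup>2) * norm (deriv (?T f) z) / e = (1 - (norm z)\<^sup>2) * norm (deriv (?T g) z)"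
      using f by (simp add: norm_mult norm_divide)
    also have "\<dots> \<le> (SUP z\<in>unit_disk. (1 - (norm z)\<^sup>2) * norm (deriv (?T g) z))"
      using Tg z by (intro cSUP_upper) (auto simp: bloch_space_def)
    also have "\<dots> \<le> bloch_norm (?T g)"
      by (simp add: bloch_norm_def)
    also have "\<dots> \<le> C"
      by (rule C[OF g])
    finally show ?thesis
      using f by (simp add: divide_le_eq)
  qed
  then show thesis
    using that by blast
qed

text \<open>
  The little Bloch space is closed in the Bloch space, in an explicit form: split \<open>f\<close> into a dilation
  \<open>g\<close> and a remainder of small mixed norm. The image of \<open>g\<close> satisfies the little-o condition, and the
  image of the remainder has small Bloch seminorm.
\<close>

lemma weighted_comp_in_little_bloch:
  assumes \<psi>: "analytic_self_map \<psi>" and u: "u holomorphic_on unit_disk" and "0 < p"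
    and \<phi>: "normal_weight \<phi>"
    and bdd: "bounded_operator (mixed_norm_space p \<phi>) (mixed_norm p \<phi>)
           bloch_space bloch_norm (weighted_comp u \<psi>)"
    and u0: "((\<lambda>z. (1 - (norm z)\<^sup>2) * norm (deriv u z)) \<longlongrightarrow> 0) to_unit_circle"
    and u\<psi>0: "((\<lambda>z. (1 - (norm z)\<^sup>2) * norm (u z * deriv \<psi> z)) \<longlongrightarrow> 0) to_unit_circle"
    and f: "f \<in> mixed_norm_space p \<phi>"
  shows "weighted_comp u \<psi> f \<in> little_bloch_space"
proof -
  let ?T = "weighted_comp u \<psi>"
  have hol: "f holomorphic_on unit_disk"
    using f by (simp add: mixed_norm_space_def)
  obtain C where C: "\<And>f e z. f \<in> mixed_norm_space p \<phi> \<Longrightarrow> mixed_norm p \<phi> f \<le> e \<Longrightarrow> 0 < e \<Longrightarrow>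
      z \<in> unit_disk \<Longrightarrow> (1 - (norm z)\<^sup>2) * norm (deriv (?T f) z) \<le> C * e"
    using bounded_operator_into_bloch_deriv_le[OF \<psi> u \<open>0 < p\<close> bdd] by blast
  define \<rho> where "\<rho> n = real n / real (Suc n)" for n
  have \<rho>: "\<rho> \<longlonglongrightarrow> 1" "\<And>n. 0 \<le> \<rho> n" "\<And>n. \<rho> n < 1"
    using LIMSEQ_n_over_Suc_n[where 'a = real] by (auto simp: \<rho>_def[abs_def])
  have "((\<lambda>z. (1 - (norm z)\<^sup>2) * norm (deriv (?T f) z)) \<longlongrightarrow> 0) to_unit_circle"
  proof (rule tendstoI)
    fix e :: real
    assume "0 < e"
    \<comment> \<open>Chosen so that \<open>C * \<delta> \<le> e / 2\<close>; nothing is known about the sign of \<open>C\<close>.\<close>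
    define \<delta> where "\<delta> = e / (2 * (\<bar>C\<bar> + 1))"
    have \<delta>: "0 < \<delta>"
      using \<open>0 < e\<close> by (simp add: \<delta>_def)
    have "C * \<delta> \<le> (\<bar>C\<bar> + 1) * \<delta>"
      using \<delta> by (intro mult_right_mono) auto
    also have "\<dots> = e / 2"
      by (simp add: \<delta>_def field_simps)
    finally have C\<delta>: "C * \<delta> \<le> e / 2" .
    let ?d = "\<lambda>n z. f z - f (of_real (\<rho> n) * z)"
    have \<rho>I: "\<rho> n \<in> {0..1}" for n
      using \<rho>(2,3)[of n] by simp
    note dil = mixed_norm_diff_dilation[OF f \<open>0 < p\<close> \<phi> \<rho>(1) \<rho>I]
    have "\<forall>\<^sub>F n in sequentially. mixed_norm p \<phi> (?d n) < \<delta>"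
      using dil(2) \<delta> by (rule order_tendstoD)
    then obtain n where n: "mixed_norm p \<phi> (?d n) < \<delta>"
      by (auto simp: eventually_sequentially)
    let ?g = "\<lambda>z. f (of_real (\<rho> n) * z)"
    have holg: "?g holomorphic_on unit_disk"
      using \<rho>I[of n] by (intro holomorphic_on_dilation hol) auto
    have hold: "?d n holomorphic_on unit_disk"
      by (intro holomorphic_on_diff hol holg)
    obtain A B where AB: "\<And>w. w \<in> unit_disk \<Longrightarrow> norm (?g w) \<le> A"
        "\<And>w. w \<in> unit_disk \<Longrightarrow> norm (deriv ?g w) \<le> B"
      using dilation_bounds[OF hol \<rho>(2,3)] by blast
    have "((\<lambda>z. (1 - (norm z)\<^sup>2) * norm (deriv (?T ?g) z)) \<longlongrightarrow> 0) to_unit_circle"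
      by (rule weighted_comp_deriv_tendsto_0[OF \<psi> u holg AB u0 u\<psi>0])
    then have "\<forall>\<^sub>F z in to_unit_circle. (1 - (norm z)\<^sup>2) * norm (deriv (?T ?g) z) < e / 2"
      by (rule order_tendstoD) (use \<open>0 < e\<close> in simp)
    then show "\<forall>\<^sub>F z in to_unit_circle. dist ((1 - (norm z)\<^sup>2) * norm (deriv (?T f) z)) 0 < e"
      using eventually_to_unit_circle_in_disk
    proof eventually_elim
      case (elim z)
      have w: "0 < 1 - (norm z)\<^sup>2"
        by (rule one_minus_norm_square_pos[OF elim(2)])
      have "deriv (?T f) z = deriv (?T ?g) z + deriv (?T (?d n)) z"
      proof -
        have *: "deriv (?T h) z = deriv u z * h (\<psi> z) + u z * (deriv h (\<psi> z) * deriv \<psi> z)"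
          if "h holomorphic_on unit_disk" for h
          by (rule DERIV_imp_deriv[OF has_field_derivative_weighted_comp[OF \<psi> u that elim(2)]])
        have "\<psi> z \<in> unit_disk"
          using \<psi> elim(2) unfolding analytic_self_map_def by blast
        then have D: "deriv (?d n) (\<psi> z) = deriv f (\<psi> z) - deriv ?g (\<psi> z)"
          using hol holg holomorphic_on_imp_differentiable_at[OF _ open_ball]
          by (intro deriv_diff) blast+
        show ?thesis
          unfolding *[OF hol] *[OF holg] *[OF hold] D by algebra
      qed
      then have "(1 - (norm z)\<^sup>2) * norm (deriv (?T f) z)
          \<le> (1 - (norm z)\<^sup>2) * (norm (deriv (?T ?g) z) + norm (deriv (?T (?d n)) z))"
        using w norm_triangle_ineq by (auto intro!: mult_left_mono)
      also have "\<dots> < e / 2 + C * \<delta>"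
        unfolding distrib_left
        using elim(1) C[OF dil(1) less_imp_le[OF n] \<delta> elim(2)] by (rule add_less_le_mono)
      finally show ?case
        using C\<delta> w by (simp add: abs_mult)
    qed
  qed
  moreover have "?T f \<in> bloch_space"
    using bdd f by (auto simp: bounded_operator_def)
  ultimately show ?thesis
    by (simp add: little_bloch_space_def)
qed

theorem theorem4p4:
  fixes \<psi> u :: "complex \<Rightarrow> complex" and p :: real and \<phi> :: "real \<Rightarrow> real"
  assumes "analytic_self_map \<psi>"
    and "u holomorphic_on unit_disk"
    and "0 < p"
    and "normal_weight \<phi>"
  shows "bounded_operator (mixed_norm_space p \<phi>) (mixed_norm p \<phi>)
           little_bloch_space bloch_norm (weighted_comp u \<psi>) \<longleftrightarrow>
         bounded_operator (mixed_norm_space p \<phi>) (mixed_norm p \<phi>)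
           bloch_space bloch_norm (weighted_comp u \<psi>) \<and>
         u \<in> little_bloch_space \<and>
         ((\<lambda>z. (1 - (norm z)\<^sup>2) * norm (u z * deriv \<psi> z)) \<longlongrightarrow> 0) to_unit_circle"
    (is "?little \<longleftrightarrow> ?bloch \<and> ?u \<and> ?lim")
proof (intro iffI conjI)
  let ?T = "weighted_comp u \<psi>" and ?X = "mixed_norm_space p \<phi>"
  assume little: ?little
  then have T: "?T f \<in> little_bloch_space" if "f \<in> ?X" for f
    using that by (auto simp: bounded_operator_def)
  show ?bloch
    using little unfolding bounded_operator_def little_bloch_space_def by blast
  have "(\<lambda>_. 1) \<in> ?X"
    by (rule bounded_holomorphic_in_mixed_norm_space[OF _ assms(3,4), of _ 1])
      (auto intro: holomorphic_intros)
  moreover have "?T (\<lambda>_. 1) = u"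
    by (simp add: weighted_comp_def)
  ultimately show u: ?u
    using T by metis
  have "(\<lambda>z. z) \<in> ?X"
    by (rule bounded_holomorphic_in_mixed_norm_space[OF _ assms(3,4), of _ 1])
      (auto intro: holomorphic_intros)
  from T[OF this] u
  have lims: "((\<lambda>z. (1 - (norm z)\<^sup>2) * norm (deriv u z)
      + (1 - (norm z)\<^sup>2) * norm (deriv (?T (\<lambda>z. z)) z)) \<longlongrightarrow> 0) to_unit_circle"
    by (auto simp: little_bloch_space_def intro!: tendsto_add_zero)
  show ?lim
  proof (rule tendsto_sandwich[OF _ _ tendsto_const lims])
    show "\<forall>\<^sub>F z in to_unit_circle. 0 \<le> (1 - (norm z)\<^sup>2) * norm (u z * deriv \<psi> z)"
      using eventually_to_unit_circle_in_disk
      by eventually_elim (rule one_minus_norm_square_mult_nonneg)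
    show "\<forall>\<^sub>F z in to_unit_circle. (1 - (norm z)\<^sup>2) * norm (u z * deriv \<psi> z)
        \<le> (1 - (norm z)\<^sup>2) * norm (deriv u z)
          + (1 - (norm z)\<^sup>2) * norm (deriv (?T (\<lambda>z. z)) z)"
      using eventually_to_unit_circle_in_disk
    proof eventually_elim
      case (elim z)
      have "\<psi> z \<in> unit_disk"
        using assms(1) elim unfolding analytic_self_map_def by blast
      then have "norm (\<psi> z) < 1"
        by simp
      have "deriv (?T (\<lambda>z. z)) z = deriv u z * \<psi> z + u z * deriv \<psi> z"
        using DERIV_imp_deriv[OF has_field_derivative_weighted_comp[OF assms(1,2) _ elim, of "\<lambda>z. z"]]
        by (simp add: holomorphic_intros)
      then have "norm (u z * deriv \<psi> z) = norm (deriv (?T (\<lambda>z. z)) z - deriv u z * \<psi> z)"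
        by simp
      also have "\<dots> \<le> norm (deriv (?T (\<lambda>z. z)) z) + norm (deriv u z) * norm (\<psi> z)"
        using norm_triangle_ineq4 by (simp flip: norm_mult)
      also have "norm (deriv u z) * norm (\<psi> z) \<le> norm (deriv u z)"
        using \<open>norm (\<psi> z) < 1\<close> by (intro mult_right_le_one_le) auto
      finally have "(1 - (norm z)\<^sup>2) * norm (u z * deriv \<psi> z)
          \<le> (1 - (norm z)\<^sup>2) * (norm (deriv (?T (\<lambda>z. z)) z) + norm (deriv u z))"
        using one_minus_norm_square_pos[OF elim] by (intro mult_left_mono) auto
      then show ?case
        by (simp add: algebra_simps)
    qed
  qed
next
  let ?T = "weighted_comp u \<psi>" and ?X = "mixed_norm_space p \<phi>"
  assume rhs: "?bloch \<and> ?u \<and> ?lim"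
  then have "?T ` ?X \<subseteq> little_bloch_space"
    using weighted_comp_in_little_bloch[OF assms] by (auto simp: little_bloch_space_def)
  with rhs show ?little
    by (auto simp: bounded_operator_def)
qed

end
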